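(* Let $(X,d)$ be an infinite $\mathbf{US}$-space generated by a labeled star graph $S(l)$ with center $c$, let $X_0:=X\setminus\{c\}$, and let $d_0$ be the restriction of $d$ to $X_0\times X_0$. Then the following statements are equivalent: (i) $(X,d)$ is compact. (ii) $(X_0,d_0)$ is generated by a labeled ray $R(l^* )$, $R=(x_1,x_2,\ldots,x_n,\ldots)$, such that $\lim_{n\to\infty} l^*(x_n)=0$ and $l^*(x_n)\ge l^*(x_{n+1})>0$ for every $n\in\mathbb{N}$.
   Context: Let $\mathbb{R}^+=[0,\infty)$. An ultrametric on a nonempty set $X$ is a symmetric function $d\colon X\times X\to\mathbb{R}^+$ with $d(x,y)=0$ iff $x=y$ and $d(x,y)\le\max\{d(x,z),d(z,y)\}$ for all $x,y,z\in X$. A tree $T$ (finite or infinite, connected simple graph without cycles, with nonempty vertex set) is a star graph with center $c\in V(T)$ if $c$ is adjacent to every other vertex and no two vertices different from $c$ are adjacent. A ray $R=(x_1,x_2,\ldots,x_n,\ldots)$ is the infinite tree with $V(R)=\{x_1,x_2,\ldots\}$ (all $x_n$ distinct) and $E(R)=\{\{x_n,x_{n+1}\}:n\in\mathbb{N}\}$. A labeled tree $T(l)$ is a tree $T$ with a labeling $l\colon V(T)\to\mathbb{R}^+$. For a labeled tree define $d_l(u,u)=0$ and, for $u\neq v$, $d_l(u,v)=\max_{w\in V(P)} l(w)$, where $P$ is the path joining $u$ and $v$ in $T$ (endpoints included). An ultrametric space $(X,d)$ is generated by $T(l)$ if $X=V(T)$ and $d=d_l$. An ultrametric space is a $\mathbf{US}$-space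 if it is generated by some labeled star graph. *)

theory Defs
  imports "HOL-Analysis.Analysis"
begin

section \<open>Ultrametric spaces\<close>

text \<open>
  As in \<^locale>\<open>Metric_space\<close>, the distance is a total function, required to be nonnegative and
  symmetric also off the carrier. This is no restriction: a distance on \<open>X \<times> X\<close> can be extended
  by 0. A subspace keeps the same function on a smaller carrier.
\<close>

locale Ultrametric_space =
  fixes X :: "'a set" and d :: "'a \<Rightarrow> 'a \<Rightarrow> real"
  assumes nonempty: "X \<noteq> {}"
    and nonneg: "\<And>x y. 0 \<le> d x y"
    and commute: "\<And>x y. d x y = d y x"
    and zero: "\<And>x y. \<lbrakk>x \<in> X; y \<in> X\<rbrakk> \<Longrightarrow> d x y = 0 \<longleftrightarrow> x = y"
    and ultra: "\<And>x y z. \<lbrakk>x \<in> X; y \<in> X; z \<in> X\<rbrakk> \<Longrightarrow> d x y \<le> max (d x z) (d z y)"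

sublocale Ultrametric_space \<subseteq> Metric_space X d
proof
  fix x y z assume "x \<in> X" "y \<in> X" "z \<in> X"
  then show "d x z \<le> d x y + d y z"
    using ultra[of x z y] nonneg[of x y] nonneg[of y z] by linarith
qed (use nonneg commute zero in auto)

section \<open>Trees, possibly infinite\<close>

record 'a sgraph =
  verts :: "'a set"
  edges :: "'a set set"

definition simple_graph :: "'a sgraph \<Rightarrow> bool" where
  "simple_graph G \<longleftrightarrow> (\<forall>e \<in> edges G. e \<subseteq> verts G \<and> card e = 2)"

definition adjacent :: "'a sgraph \<Rightarrow> 'a \<Rightarrow> 'a \<Rightarrow> bool" where
  "adjacent G u v \<longleftrightarrow> {u, v} \<in> edges G"

text \<open>Paths and cycles are finite lists of distinct vertices.\<close>

definition path_between :: "'a sgraph \<Rightarrow> 'a \<Rightarrow> 'a list \<Rightarrow> 'a \<Rightarrow> bool" where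
  "path_between G u p v \<longleftrightarrow>
     p \<noteq> [] \<and> hd p = u \<and> last p = v \<and> set p \<subseteq> verts G \<and> distinct p \<and>
     successively (adjacent G) p"

definition cycle_in :: "'a sgraph \<Rightarrow> 'a list \<Rightarrow> bool" where
  "cycle_in G p \<longleftrightarrow>
     length p \<ge> 3 \<and> set p \<subseteq> verts G \<and> distinct p \<and>
     successively (adjacent G) p \<and> adjacent G (last p) (hd p)"

definition connected_graph :: "'a sgraph \<Rightarrow> bool" where
  "connected_graph G \<longleftrightarrow> (\<forall>u \<in> verts G. \<forall>v \<in> verts G. \<exists>p. path_between G u p v)"

definition tree_graph :: "'a sgraph \<Rightarrow> bool" where
  "tree_graph T \<longleftrightarrow>
     simple_graph T \<and> verts T \<noteq> {} \<and> connected_graph T \<and> (\<nexists>p. cycle_in T p)"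

definition star_graph :: "'a sgraph \<Rightarrow> 'a \<Rightarrow> bool" where
  "star_graph S c \<longleftrightarrow>
     tree_graph S \<and> c \<in> verts S \<and>
     (\<forall>v \<in> verts S - {c}. adjacent S c v) \<and>
     (\<forall>u \<in> verts S - {c}. \<forall>v \<in> verts S - {c}. \<not> adjacent S u v)"

text \<open>For injective \<open>x\<close>, the ray \<open>(x 0, x 1, x 2, \<dots>)\<close>.\<close>

definition ray_graph :: "(nat \<Rightarrow> 'a) \<Rightarrow> 'a sgraph" where
  "ray_graph x = \<lparr>verts = range x, edges = {{x n, x (Suc n)} | n. True}\<rparr>"

section \<open>Labeled trees and generated ultrametric spaces\<close>

definition labeled_tree :: "'a sgraph \<Rightarrow> ('a \<Rightarrow> real) \<Rightarrow> bool" where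
  "labeled_tree T l \<longleftrightarrow> tree_graph T \<and> (\<forall>v \<in> verts T. 0 \<le> l v)"

text \<open>In a tree the path from \<open>u\<close> to \<open>v\<close> is unique, so \<open>THE\<close> is well-defined for vertices.\<close>

definition label_dist :: "'a sgraph \<Rightarrow> ('a \<Rightarrow> real) \<Rightarrow> 'a \<Rightarrow> 'a \<Rightarrow> real" where
  "label_dist T l u v =
     (if u = v then 0 else Max (l ` set (THE p. path_between T u p v)))"

definition generated_by ::
    "'a set \<Rightarrow> ('a \<Rightarrow> 'a \<Rightarrow> real) \<Rightarrow> 'a sgraph \<Rightarrow> ('a \<Rightarrow> real) \<Rightarrow> bool" where
  "generated_by X d T l \<longleftrightarrow>
     Ultrametric_space X d \<and> labeled_tree T l \<and> X = verts T \<and>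
     (\<forall>u \<in> X. \<forall>v \<in> X. d u v = label_dist T l u v)"

end

theory Submission
  imports Defs
begin

text \<open>
  In the star, distinct points \<open>u\<close>, \<open>v\<close> have distance \<open>max (l c) (max (l u) (l v))\<close>; in a ray with
  decreasing labels, the distance of two vertices is the label of the earlier one. A separated subset
  of a compact space is finite. Hence compactness forces \<open>l c = 0\<close> and leaves only finitely many
  vertices with label at least \<open>e\<close>, for every \<open>e > 0\<close>, so that the vertices other than \<open>c\<close> can be
  enumerated by decreasing label, and the same labels generate \<open>X - {c}\<close> along this ray. Conversely,
  the label of \<open>x n\<close> in the ray bounds both \<open>l c\<close> and \<open>l (x n)\<close>, so \<open>x\<close> converges to \<open>c\<close>, and a
  sequence together with its limit is compact.
\<close>

section \<open>Paths\<close>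

lemma adjacent_commute: "adjacent G u v \<longleftrightarrow> adjacent G v u"
  by (simp add: adjacent_def insert_commute)

lemma path_between_rev: "path_between G u (rev p) v \<longleftrightarrow> path_between G v p u"
proof -
  have "successively (\<lambda>x y. adjacent G y x) p \<longleftrightarrow> successively (adjacent G) p"
    by (rule successively_cong) (simp_all add: adjacent_commute)
  then show ?thesis
    by (auto simp: path_between_def hd_rev last_rev)
qed

text \<open>Eliminates the definite description in \<open>label_dist\<close>. Uniqueness of paths is
  proved below for stars and rays separately, so no uniqueness theorem for general trees
  enters.\<close>

lemma label_dist_eqI:
  assumes "u \<noteq> v" "path_between T u p v" "\<And>q. path_between T u q v \<Longrightarrow> q = p"
  shows "label_dist T l u v = Max (l ` set p)"
proof -
  have "(THE p. path_between T u p v) = p"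
    using assms by blast
  with assms(1) show ?thesis
    by (simp add: label_dist_def)
qed

section \<open>Distances in a star\<close>

lemma star_graph_adjacent_iff:
  assumes "star_graph S c" "u \<in> verts S" "v \<in> verts S"
  shows "adjacent S u v \<longleftrightarrow> u \<noteq> v \<and> (u = c \<or> v = c)"
proof -
  have "\<not> adjacent S w w" for w
    using assms(1)
    by (force simp: star_graph_def tree_graph_def simple_graph_def adjacent_def)
  then show ?thesis
    using assms adjacent_commute[of S] by (auto simp: star_graph_def)
qed

text \<open>After the first step from \<open>c\<close> to some \<open>w\<close>, the only vertex to
  move on to is \<open>c\<close> again, which distinctness forbids.\<close>

lemma star_path_center_unique:
  assumes S: "star_graph S c" and p: "path_between S c p v" and "v \<noteq> c"
  shows "p = [c, v]"
proof -
  obtain q where q: "p = c # q" "q \<noteq> []"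
    using p \<open>v \<noteq> c\<close> by (cases p) (auto simp: path_between_def split: if_splits)
  then obtain w r where r: "p = c # w # r"
    by (cases q) auto
  have "r = []"
  proof (cases r)
    case (Cons y s)
    then show ?thesis
      using p r star_graph_adjacent_iff[OF S, of w y] by (auto simp: path_between_def)
  qed
  with p r show ?thesis
    by (auto simp: path_between_def)
qed

text \<open>The first step from a leaf must lead to \<open>c\<close>, and what follows is a path
  starting at the center.\<close>

lemma star_path_unique:
  assumes S: "star_graph S c" and p: "path_between S u p v" and "u \<noteq> v" "u \<noteq> c" "v \<noteq> c"
  shows "p = [u, c, v]"
proof -
  obtain q where q: "p = u # q" "q \<noteq> []"
    using p \<open>u \<noteq> v\<close> by (cases p) (auto simp: path_between_def split: if_splits)
  then obtain w r where r: "p = u # w # r"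
    by (cases q) auto
  have w: "w = c"
    using p r \<open>u \<noteq> c\<close> star_graph_adjacent_iff[OF S, of u w] by (auto simp: path_between_def)
  then have "path_between S c (w # r) v"
    using p r by (auto simp: path_between_def)
  then show ?thesis
    using star_path_center_unique[OF S] \<open>v \<noteq> c\<close> r by blast
qed

lemma star_label_dist:
  assumes S: "star_graph S c" and "u \<in> verts S" "v \<in> verts S" "u \<noteq> v"
  shows "label_dist S l u v = max (l c) (max (l u) (l v))"
proof -
  note adj = star_graph_adjacent_iff[OF S]
  have c: "c \<in> verts S"
    using S by (simp add: star_graph_def)
  consider "u = c" | "v = c" | "u \<noteq> c" "v \<noteq> c" by blast
  then show ?thesis
  proof cases
    case 1
    have "path_between S c [c, v] v"
      using 1 assms c adj by (auto simp: path_between_def)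
    from label_dist_eqI[OF _ this, of l] show ?thesis
      using 1 assms star_path_center_unique[OF S] by auto
  next
    case 2
    have pth: "path_between S u [u, c] c"
      using 2 assms c adj by (auto simp: path_between_def)
    have "q = [u, c]" if "path_between S u q c" for q
      using star_path_center_unique[OF S, of "rev q" u] that path_between_rev[of S c q u] 2 assms
      by (simp add: rev_swap)
    from label_dist_eqI[OF _ pth this, of l] show ?thesis
      using 2 assms by (simp add: max.commute)
  next
    case 3
    have "path_between S u [u, c, v] v"
      using 3 assms c adj by (auto simp: path_between_def)
    from label_dist_eqI[OF _ this, of l] show ?thesis
      using 3 assms star_path_unique[OF S] by (auto simp: max.left_commute)
  qed
qed

section \<open>Distances in a ray\<close>

lemma verts_ray_graph: "verts (ray_graph x) = range x"
  by (simp add: ray_graph_def)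

lemma ray_graph_adjacent_iff:
  assumes "inj x"
  shows "adjacent (ray_graph x) (x m) (x n) \<longleftrightarrow> n = Suc m \<or> m = Suc n"
  using assms by (auto simp: adjacent_def ray_graph_def doubleton_eq_iff inj_eq)

text \<open>A walk on the natural numbers by steps of one that repeats no number cannot turn back,
  so its first step fixes its direction. Spelling out the first two entries keeps that direction
  through the induction.\<close>

lemma upward_walk:
  assumes "successively (\<lambda>i j. j = Suc i \<or> i = Suc j) (a # Suc a # p)" "distinct (a # Suc a # p)"
  shows "a # Suc a # p = [a..<Suc (last (Suc a # p))] \<and> a < last (Suc a # p)"
  using assms
proof (induction p arbitrary: a)
  case (Cons b p)
  then have "b = Suc (Suc a)"
    by auto
  with Cons.IH[of "Suc a"] Cons.prems show ?case
    by (auto simp: upt_conv_Cons)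
qed simp

text \<open>The mirror image of \<open>upward_walk\<close>. A bound on the endpoint suffices, since
  it only serves to exclude that a path starting downwards ends at a larger index.\<close>

lemma downward_walk:
  assumes "successively (\<lambda>i j. j = Suc i \<or> i = Suc j) (Suc a # a # p)" "distinct (Suc a # a # p)"
  shows "last (a # p) \<le> a"
  using assms
proof (induction p arbitrary: a)
  case (Cons b p)
  then have "a = Suc b"
    by auto
  with Cons.IH[of b] Cons.prems show ?case
    by auto
qed simp

text \<open>Pulled back along the injection \<open>x\<close>, the path becomes a list of indices
  with steps of one, to which the two walk lemmas apply.\<close>

lemma ray_path_unique:
  assumes x: "inj x" and p: "path_between (ray_graph x) (x m) p (x n)" and "m < n"
  shows "p = map x [m..<Suc n]"
proof -
  have "set p \<subseteq> range x"
    using p by (simp add: path_between_def ray_graph_def)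
  then obtain q where q: "p = map x q"
    by (metis ex_map_conv subsetD rangeE)
  have *: "q \<noteq> []" "hd q = m" "last q = n" "distinct q"
    using p x by (auto simp: path_between_def q hd_map last_map inj_eq distinct_map)
  have succ: "successively (\<lambda>i j. j = Suc i \<or> i = Suc j) q"
    using p by (simp add: path_between_def q successively_map ray_graph_adjacent_iff[OF x])
  obtain b r where r: "q = m # b # r"
    using * \<open>m < n\<close> by (cases q; cases "tl q") auto
  then consider "b = Suc m" | "m = Suc b"
    using succ by auto
  then show ?thesis
  proof cases
    case 1
    then show ?thesis
      using upward_walk[of m r] succ * r q by simp
  next
    case 2
    then show ?thesis
      using downward_walk[of b r] succ * r \<open>m < n\<close> by auto
  qed
qed

lemma ray_path_upt:
  assumes x: "inj x" and "m \<le> n"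
  shows "path_between (ray_graph x) (x m) (map x [m..<Suc n]) (x n)"
proof -
  have "successively (\<lambda>i j. j = Suc i \<or> i = Suc j) [m..<Suc n]"
    by (induction n) (auto simp: successively_append_iff last_upt)
  moreover have "inj_on x A" for A
    using x inj_on_subset by blast
  ultimately show ?thesis
    using assms
    by (auto simp: path_between_def hd_map last_map distinct_map successively_map
        ray_graph_adjacent_iff verts_ray_graph simp del: upt_Suc)
qed

text \<open>For acyclicity: a cycle, cut at its closing edge, would be a path with at least three
  vertices between two neighbours, but the unique path between neighbours has only two.\<close>

lemma tree_graph_ray_graph:
  assumes x: "inj x"
  shows "tree_graph (ray_graph x)"
proof -
  have "simple_graph (ray_graph x)"
    using x by (auto simp: simple_graph_def ray_graph_def card_insert_if inj_eq)
  moreover have "\<exists>p. path_between (ray_graph x) (x m) p (x n)" for m n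
    using ray_path_upt[OF x, of m n] ray_path_upt[OF x, of n m] path_between_rev
    by (metis nle_le)
  then have "connected_graph (ray_graph x)"
    by (auto simp: connected_graph_def ray_graph_def)
  moreover have False if cyc: "cycle_in (ray_graph x) p" for p
  proof -
    have "p \<noteq> []" and len: "length p \<ge> 3" and dist: "distinct p"
      using cyc by (auto simp: cycle_in_def)
    moreover have "hd p \<in> range x" "last p \<in> range x"
      using cyc \<open>p \<noteq> []\<close> by (auto simp: cycle_in_def ray_graph_def)
    then obtain m n where mn: "hd p = x m" "last p = x n"
      by blast
    ultimately have p: "path_between (ray_graph x) (x m) p (x n)"
      using cyc by (auto simp: cycle_in_def path_between_def)
    have "n = Suc m \<or> m = Suc n"
      using cyc mn ray_graph_adjacent_iff[OF x] by (auto simp: cycle_in_def)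
    then show False
    proof
      assume "n = Suc m"
      then show False
        using ray_path_unique[OF x p] len by simp
    next
      assume "m = Suc n"
      then show False
        using ray_path_unique[OF x, of n "rev p" m] p len by (simp add: path_between_rev rev_swap)
    qed
  qed
  ultimately show ?thesis
    by (auto simp: tree_graph_def ray_graph_def)
qed

lemma ray_label_dist:
  assumes x: "inj x" and l: "decseq (\<lambda>n. l (x n))" and "m < n"
  shows "label_dist (ray_graph x) l (x m) (x n) = l (x m)"
    and "label_dist (ray_graph x) l (x n) (x m) = l (x m)"
proof -
  let ?p = "map x [m..<Suc n]"
  have ne: "x m \<noteq> x n"
    using x \<open>m < n\<close> by (simp add: inj_eq)
  have Max: "Max (l ` set ?p) = l (x m)"
    using l \<open>m < n\<close> by (intro Max_eqI) (auto simp: decseq_def)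
  have p: "path_between (ray_graph x) (x m) ?p (x n)"
    using ray_path_upt[OF x] \<open>m < n\<close> by simp
  show "label_dist (ray_graph x) l (x m) (x n) = l (x m)"
    using label_dist_eqI[OF ne p] ray_path_unique[OF x _ \<open>m < n\<close>] Max by simp
  have "label_dist (ray_graph x) l (x n) (x m) = Max (l ` set (rev ?p))"
  proof (rule label_dist_eqI)
    show "path_between (ray_graph x) (x n) (rev ?p) (x m)"
      using p path_between_rev by metis
    show "q = rev ?p" if "path_between (ray_graph x) (x n) q (x m)" for q
      using ray_path_unique[OF x _ \<open>m < n\<close>, of "rev q"] that path_between_rev by (metis rev_rev_ident)
  qed (use ne in auto)
  with Max show "label_dist (ray_graph x) l (x n) (x m) = l (x m)"
    by simp
qed

section \<open>Compactness\<close>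

text \<open>By total boundedness finitely many balls of radius \<open>e\<close> cover the space. The
  strong triangle inequality puts any two points of one such ball at distance less than
  \<open>e\<close>, so each ball holds at most one point of \<open>A\<close>, and there is no need
  to halve the radius.\<close>

lemma (in Ultrametric_space) finite_separated:
  assumes "compact_space mtopology" "A \<subseteq> X" "0 < e"
    and sep: "\<And>x y. \<lbrakk>x \<in> A; y \<in> A; x \<noteq> y\<rbrakk> \<Longrightarrow> e \<le> d x y"
  shows "finite A"
proof -
  have "mtotally_bounded X"
    using assms(1) compactin_imp_mtotally_bounded by (simp add: compact_space_def)
  with \<open>0 < e\<close> have "\<exists>K. finite K \<and> K \<subseteq> X \<and> X \<subseteq> (\<Union>k\<in>K. mball k e)"
    by (simp add: mtotally_bounded_def)
  then obtain K where K: "finite K" "K \<subseteq> X" "X \<subseteq> (\<Union>k\<in>K. mball k e)"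
    by (elim exE conjE)
  then have "\<forall>a\<in>A. \<exists>k\<in>K. a \<in> mball k e"
    using \<open>A \<subseteq> X\<close> by blast
  then obtain k where k: "\<And>a. a \<in> A \<Longrightarrow> k a \<in> K \<and> a \<in> mball (k a) e"
    by metis
  have "inj_on k A"
  proof (rule inj_onI, rule ccontr)
    fix a b assume ab: "a \<in> A" "b \<in> A" "k a = k b" "a \<noteq> b"
    then have "d a b \<le> max (d a (k a)) (d (k a) b)"
      using ultra k K(2) \<open>A \<subseteq> X\<close> by blast
    moreover have "d a (k a) < e" "d (k a) b < e"
      using k[OF ab(1)] k[OF ab(2)] ab(3) commute[of a] by auto
    ultimately show False
      using sep[OF ab(1,2,4)] by linarith
  qed
  then show "finite A"
    using K(1) k by (meson finite_imageD finite_subset image_subsetI)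
qed

text \<open>The enumeration repeatedly removes an element of largest label.\<close>

lemma decreasing_enumeration:
  fixes l :: "'a \<Rightarrow> real"
  assumes "infinite A" and pos: "\<And>a. a \<in> A \<Longrightarrow> 0 < l a"
    and fin: "\<And>e. 0 < e \<Longrightarrow> finite {a \<in> A. e \<le> l a}"
  obtains x :: "nat \<Rightarrow> 'a"
  where "bij_betw x UNIV A" "decseq (\<lambda>n. l (x n))" "(\<lambda>n. l (x n)) \<longlonglongrightarrow> 0"
proof -
  have "\<exists>b\<in>B. \<forall>a\<in>B. l a \<le> l b" if B: "B \<subseteq> A" "B \<noteq> {}" for B
  proof -
    obtain b where b: "b \<in> B" using B by blast
    \<comment> \<open>An arbitrary \<open>b\<close> cuts \<open>B\<close> down to a finite set that
      contains all candidates for the largest label.\<close>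
    let ?C = "{a \<in> B. l b \<le> l a}"
    have fin_C: "finite ?C"
      using b B(1) by (intro finite_subset[OF _ fin[OF pos, of b]]) auto
    then have "Max (l ` ?C) \<in> l ` ?C"
      using b by (intro Max_in) auto
    then obtain m where m: "m \<in> ?C" "Max (l ` ?C) = l m"
      by (rule imageE)
    then have "l a \<le> l m" if "a \<in> ?C" for a
      using Max_ge[of "l ` ?C" "l a"] fin_C that by simp
    then have "l a \<le> l m" if "a \<in> B" for a
      using m(1) that by (cases "l b \<le> l a") auto
    then show ?thesis
      using m(1) by blast
  qed
  then obtain g where g: "\<And>B. B \<subseteq> A \<Longrightarrow> B \<noteq> {} \<Longrightarrow> g B \<in> B \<and> (\<forall>a\<in>B. l a \<le> l (g B))"
    by metis
  \<comment> \<open>\<open>R n\<close> is what remains of \<open>A\<close> after \<open>n\<close>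
    removals, and \<open>x n\<close> is the element removed next.\<close>
  define R where "R n = ((\<lambda>B. B - {g B}) ^^ n) A" for n
  define x where "x n = g (R n)" for n
  have R_Suc: "R (Suc n) = R n - {x n}" for n
    by (simp add: R_def x_def)
  have R: "R n \<subseteq> A \<and> infinite (R n)" for n
  proof (induction n)
    case 0
    then show ?case using \<open>infinite A\<close> by (simp add: R_def)
  qed (auto simp: R_Suc)
  have x_in: "x n \<in> R n" and x_max: "\<And>a. a \<in> R n \<Longrightarrow> l a \<le> l (x n)" for n
    using g[of "R n"] R[of n] unfolding x_def by (metis infinite_imp_nonempty)+
  have R_mono: "R n \<subseteq> R m" if "m \<le> n" for m n
    using that by (rule lift_Suc_antimono_le[rotated]) (auto simp: R_Suc)
  have dec: "decseq (\<lambda>n. l (x n))"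
    unfolding decseq_def using x_in x_max R_mono by blast
  have x_ne: "x m \<noteq> x n" if "m < n" for m n
    using x_in[of n] R_mono[of "Suc m" n] that by (auto simp: R_Suc)
  have inj: "inj x"
    by (rule linorder_inj_onI') (rule x_ne)
  have fin_ge: "finite {n. e \<le> l (x n)}" if "0 < e" for e
  proof -
    have "finite (x -` {a \<in> A. e \<le> l a})"
      using fin[OF that] inj by (rule finite_vimageI)
    then show ?thesis
      by (rule rev_finite_subset) (use x_in R in auto)
  qed
  \<comment> \<open>An element never chosen would stay in every \<open>R n\<close>, so every
    \<open>x n\<close> would have label at least \<open>l a\<close>, against the finiteness in
    \<open>fin_ge\<close>.\<close>
  have "a \<in> range x" if a: "a \<in> A" for a
  proof (rule ccontr)
    assume "a \<notin> range x"
    have "a \<in> R n" for n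
      by (induction n) (use a \<open>a \<notin> range x\<close> in \<open>auto simp: R_Suc R_def[of 0]\<close>)
    then have "{n. l a \<le> l (x n)} = UNIV"
      using x_max by auto
    then show False
      using fin_ge[OF pos[OF a]] by simp
  qed
  then have "bij_betw x UNIV A"
    using inj x_in R by (auto simp: bij_betw_def)
  moreover have "(\<lambda>n. l (x n)) \<longlonglongrightarrow> 0"
  proof (rule order_tendstoI)
    fix e :: real assume "e < 0"
    then show "\<forall>\<^sub>F n in sequentially. e < l (x n)"
      using pos x_in R by (intro always_eventually allI) (meson order_less_trans subsetD)
  next
    fix e :: real assume "0 < e"
    then show "\<forall>\<^sub>F n in sequentially. l (x n) < e"
      using fin_ge by (simp flip: cofinite_eq_sequentially add: eventually_cofinite not_less)
  qed
  ultimately show thesis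
    using dec that by blast
qed

theorem theorem5p3:
  fixes X :: "'a set" and d :: "'a \<Rightarrow> 'a \<Rightarrow> real"
    and S :: "'a sgraph" and l :: "'a \<Rightarrow> real" and c :: 'a
  assumes "infinite X"
    and "star_graph S c"
    and "generated_by X d S l"
  shows "compact_space (Metric_space.mtopology X d) \<longleftrightarrow>
    (\<exists>(x :: nat \<Rightarrow> 'a) (l' :: 'a \<Rightarrow> real).
       inj x \<and>
       generated_by (X - {c}) d (ray_graph x) l' \<and>
       (\<lambda>n. l' (x n)) \<longlonglongrightarrow> 0 \<and>
       (\<forall>n. l' (x n) \<ge> l' (x (Suc n)) \<and> l' (x (Suc n)) > 0))"
    (is "?L \<longleftrightarrow> ?R")
proof -
  interpret Ultrametric_space X d
    using assms(3) unfolding generated_by_def by blast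
  have c: "c \<in> X" and l_ge: "\<And>v. v \<in> X \<Longrightarrow> 0 \<le> l v"
    using assms(2,3) by (auto simp: generated_by_def star_graph_def labeled_tree_def)
  have d_eq: "d u v = max (l c) (max (l u) (l v))" if "u \<in> X" "v \<in> X" "u \<noteq> v" for u v
    using that assms(3) star_label_dist[OF assms(2)] by (simp add: generated_by_def)
  \<comment> \<open>Infinity of \<open>X\<close> guarantees that \<open>X - {c}\<close> is
    nonempty.\<close>
  have sub: "Ultrametric_space (X - {c}) d"
    using assms(1) nonneg commute zero ultra
    by unfold_locales (auto dest: infinite_imp_nonempty[OF infinite_remove])
  show ?thesis
  proof
    assume L: ?L
    have "l c = 0"
    proof (rule ccontr)
      assume "l c \<noteq> 0"
      \<comment> \<open>If \<open>l c\<close> were positive, all of \<open>X\<close> would be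
        separated by \<open>l c\<close>.\<close>
      then have "finite X"
        using l_ge[OF c] by (intro finite_separated[OF L, of X "l c"]) (auto simp: d_eq)
      with assms(1) show False by simp
    qed
    then have d_eq: "d u v = max (l u) (l v)" if "u \<in> X" "v \<in> X" "u \<noteq> v" for u v
      using that d_eq l_ge by (simp add: max.absorb2 le_max_iff_disj)
    \<comment> \<open>Once \<open>l c = 0\<close>, the label of \<open>v\<close> is its distance
      from \<open>c\<close>.\<close>
    have pos: "0 < l v" if "v \<in> X - {c}" for v
      using that mdist_pos_less[of c v] c d_eq[of c v] l_ge[of v] \<open>l c = 0\<close> by auto
    have "finite {v \<in> X - {c}. e \<le> l v}" if "0 < e" for e
      using that by (intro finite_separated[OF L, of _ e]) (auto simp: d_eq)
    then obtain x :: "nat \<Rightarrow> 'a" where x: "bij_betw x UNIV (X - {c})"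
      and dec: "decseq (\<lambda>n. l (x n))" and lim: "(\<lambda>n. l (x n)) \<longlonglongrightarrow> 0"
      using decreasing_enumeration[of "X - {c}" l] pos assms(1) by auto
    have inj: "inj x" and ran: "X - {c} = range x"
      using x by (auto simp: bij_betw_def)
    have xX: "x n \<in> X" for n
      using ran by blast
    have max_l: "max (l (x m)) (l (x n)) = l (x m)" if "m < n" for m n
      using decseqD[OF dec, of m n] that by simp
    have "d (x m) (x n) = label_dist (ray_graph x) l (x m) (x n)" for m n
    proof (cases m n rule: linorder_cases)
      case less
      then show ?thesis
        using ray_label_dist(1)[where l = l, OF inj dec] d_eq[OF xX xX, of m n] inj
          max_l[of m n] by (simp add: inj_eq max.commute)
    next
      case equal
      then show ?thesis
        using xX by (simp add: label_dist_def)
    next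
      case greater
      then show ?thesis
        using ray_label_dist(2)[where l = l, OF inj dec] d_eq[OF xX xX, of m n] inj
          max_l[of n m] by (simp add: inj_eq max.commute)
    qed
    \<comment> \<open>The labeling of the star itself serves as the labeling of the ray.\<close>
    then have "generated_by (X - {c}) d (ray_graph x) l"
      using sub tree_graph_ray_graph[OF inj] l_ge[OF xX] ran
      by (auto simp: generated_by_def labeled_tree_def ray_graph_def)
    moreover have "l (x (Suc n)) \<le> l (x n) \<and> 0 < l (x (Suc n))" for n
      using decseqD[OF dec, of n "Suc n"] pos ran by auto
    ultimately show ?R
      using inj lim by blast
  next
    assume ?R
    then obtain x l' where inj: "inj x" and gen: "generated_by (X - {c}) d (ray_graph x) l'"
      and lim: "(\<lambda>n. l' (x n)) \<longlonglongrightarrow> 0" and "\<And>n. l' (x (Suc n)) \<le> l' (x n)"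
      by blast
    then have dec: "decseq (\<lambda>n. l' (x n))"
      by (simp add: decseq_Suc_iff)
    have ran: "X - {c} = range x"
      using gen by (simp add: generated_by_def ray_graph_def)
    \<comment> \<open>The distance of consecutive ray vertices is computed twice: the ray gives
      \<open>l' (x n)\<close>, the star a maximum that includes both \<open>l c\<close> and
      \<open>l (x n)\<close>.\<close>
    have le: "max (l c) (l (x n)) \<le> l' (x n)" for n
    proof -
      have "d (x n) (x (Suc n)) = l' (x n)"
        using gen ran ray_label_dist(1)[where l = l', OF inj dec, of n "Suc n"]
        by (auto simp: generated_by_def)
      moreover have "d (x n) (x (Suc n)) = max (l c) (max (l (x n)) (l (x (Suc n))))"
        using ran inj by (intro d_eq) (auto simp: inj_eq)
      ultimately show ?thesis
        by linarith
    qed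
    \<comment> \<open>By the star formula this distance is exactly
      \<open>max (l c) (l (x n))\<close>.\<close>
    have "d (x n) c \<le> l' (x n)" for n
      using d_eq[of "x n" c] c ran le[of n] by force
    then have "(\<lambda>n. d (x n) c) \<longlonglongrightarrow> 0"
      by (intro tendsto_sandwich[OF _ _ tendsto_const lim] always_eventually) auto
    moreover have ran_sub: "range x \<subseteq> X"
      using ran by blast
    then have "\<forall>\<^sub>F n in sequentially. x n \<in> X"
      by (intro always_eventually) blast
    ultimately have "limitin mtopology x c sequentially"
      using c by (simp add: limitin_metric_dist_null)
    then have "compactin mtopology (insert c (range x))"
      using ran_sub by (intro compactin_sequence_with_limit) auto
    moreover have "insert c (range x) = X"
      using c ran by auto
    ultimately show ?L
      by (simp add: compact_space_def)
  qed
qed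

end
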